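(* The following inclusions of sets of rational numbers hold: $$\mathfrak{S}_c(\mathfrak R)\subseteq\mathfrak{S}_c(\mathfrak{G}_{nil}^{(2)})\subseteq \mathfrak{S}_{ann}(\mathfrak{R}_{sa}\cap\mathfrak R_{nil}^{(2)}).$$ That is, every commuting probability of a finite ring is the commuting probability of some finite nilpotent group of class $\leq 2$, and every commuting probability of a finite nilpotent group of class $\leq 2$ is the annihilating probability of some finite strongly antisymmetric ring that is nilpotent of class $\leq 3$.
   Context: Rings are not assumed to be associative or unitary (a ring is an abelian group with a multiplication that is distributive over addition on both sides). Commuting probability: for a finite group $G$, $\mathrm{Pr}_c(G)=|\{(a,b)\in G\times G : ab=ba\}|/|G|^2$; for a finite ring $R$, $\mathrm{Pr}_c(R)=|\{(x,y)\in R\times R : xy-yx=0\}|/|R|^2$. Annihilating probability of a finite ring $R$: $\mathrm{Pr}_{ann}(R)=|\{(x,y)\in R\times R : xy=0\}|/|R|^2$. For a class $\mathcal C$ of finite groups or finite rings, $\mathfrak S_c(\mathcal C)=\{\mathrm{Pr}_c(A): A\in\mathcal C\}$, and for a class $\mathcal C$ of finite rings, $\mathfrak S_{ann}(\mathcal C)=\{\mathrm{Pr}_{ann}(R): R\in\mathcal C\}$. A ring $R$ is strongly antisymmetric if $a^2=0$ for all $a\in R$. A ring is nilpotent of class $\leq n$ if the product of any $n$ elements, with any correct distribution of brackets, is zero (so class $\leq 3$ means that all products $(ab)c$ and $a(bc)$ vanish). A group is nilpotent of class $\leq 2$ if all commutators are central. Classes: $\mathfrak R$ is the class of finite rings; $\mathfrak{G}_{nil}^{(2)}$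 is the class of finite nilpotent groups of class $\leq 2$; $\mathfrak{R}_{nil}^{(2)}$ is the class of finite nilpotent rings of class $\leq 3$; $\mathfrak{R}_{sa}$ is the class of finite strongly antisymmetric rings. *)

theory Defs
  imports Complex_Main "HOL-Algebra.Generated_Groups" "HOL-Algebra.Ring"
begin

section \<open>Rings that need be neither associative nor unital\<close>

text \<open>
  The library locale \<open>ring\<close> is associative and unital. The locale below uses the same records, but
  imposes nothing on the record field \<open>one\<close>, which carries no information here.
\<close>

locale nonassoc_ring = abelian_group R for R (structure) +
  assumes mult_closed: "\<lbrakk>x \<in> carrier R; y \<in> carrier R\<rbrakk> \<Longrightarrow> x \<otimes> y \<in> carrier R"
    and mult_add_left:
      "\<lbrakk>x \<in> carrier R; y \<in> carrier R; z \<in> carrier R\<rbrakk> \<Longrightarrow> (x \<oplus> y) \<otimes> z = x \<otimes> z \<oplus> y \<otimes> z"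
    and mult_add_right:
      "\<lbrakk>x \<in> carrier R; y \<in> carrier R; z \<in> carrier R\<rbrakk> \<Longrightarrow> z \<otimes> (x \<oplus> y) = z \<otimes> x \<oplus> z \<otimes> y"

definition strongly_antisymmetric :: "('a, 'm) ring_scheme \<Rightarrow> bool" where
  "strongly_antisymmetric R \<longleftrightarrow> (\<forall>a\<in>carrier R. a \<otimes>\<^bsub>R\<^esub> a = \<zero>\<^bsub>R\<^esub>)"

text \<open>
  \<open>bracketed_product R n x\<close>: the element \<open>x\<close> is a product of \<open>n\<close> elements of \<open>R\<close> with respect to
  some correct distribution of brackets.
\<close>

inductive bracketed_product :: "('a, 'm) ring_scheme \<Rightarrow> nat \<Rightarrow> 'a \<Rightarrow> bool" for R where
  single: "x \<in> carrier R \<Longrightarrow> bracketed_product R 1 x"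
| mult: "\<lbrakk>bracketed_product R m x; bracketed_product R n y\<rbrakk>
    \<Longrightarrow> bracketed_product R (m + n) (x \<otimes>\<^bsub>R\<^esub> y)"

definition ring_nilpotent_class_le :: "nat \<Rightarrow> ('a, 'm) ring_scheme \<Rightarrow> bool" where
  "ring_nilpotent_class_le n R \<longleftrightarrow> (\<forall>x. bracketed_product R n x \<longrightarrow> x = \<zero>\<^bsub>R\<^esub>)"

lemma bracketed_product_pos: "bracketed_product R n x \<Longrightarrow> 0 < n"
  by (induction rule: bracketed_product.induct) auto

lemma bracketed_product_1: "bracketed_product R (Suc 0) x \<longleftrightarrow> x \<in> carrier R"
proof
  assume "bracketed_product R (Suc 0) x"
  then show "x \<in> carrier R"
    by cases (auto dest!: bracketed_product_pos)
next
  show "x \<in> carrier R \<Longrightarrow> bracketed_product R (Suc 0) x"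
    using bracketed_product.single[of x R] by simp
qed

lemma bracketed_product_2:
  "bracketed_product R 2 x \<longleftrightarrow> (\<exists>a\<in>carrier R. \<exists>b\<in>carrier R. x = a \<otimes>\<^bsub>R\<^esub> b)"
proof
  assume "bracketed_product R 2 x"
  then show "\<exists>a\<in>carrier R. \<exists>b\<in>carrier R. x = a \<otimes>\<^bsub>R\<^esub> b"
  proof cases
    case (mult m y n z)
    then have "m = Suc 0" "n = Suc 0"
      using bracketed_product_pos[OF mult(3)] bracketed_product_pos[OF mult(4)] by auto
    with mult show ?thesis by (auto simp: bracketed_product_1)
  qed simp
next
  assume "\<exists>a\<in>carrier R. \<exists>b\<in>carrier R. x = a \<otimes>\<^bsub>R\<^esub> b"
  then show "bracketed_product R 2 x"
    using bracketed_product.mult[of R "Suc 0" _ "Suc 0"]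
    by (auto simp: bracketed_product_1 numeral_2_eq_2)
qed

lemma ring_nilpotent_class_le_3_iff:
  "ring_nilpotent_class_le 3 R \<longleftrightarrow>
     (\<forall>a\<in>carrier R. \<forall>b\<in>carrier R. \<forall>c\<in>carrier R.
        (a \<otimes>\<^bsub>R\<^esub> b) \<otimes>\<^bsub>R\<^esub> c = \<zero>\<^bsub>R\<^esub> \<and> a \<otimes>\<^bsub>R\<^esub> (b \<otimes>\<^bsub>R\<^esub> c) = \<zero>\<^bsub>R\<^esub>)"
  (is "_ \<longleftrightarrow> ?rhs")
proof
  assume nil: "ring_nilpotent_class_le 3 R"
  show ?rhs
  proof (intro ballI)
    fix a b c assume abc: "a \<in> carrier R" "b \<in> carrier R" "c \<in> carrier R"
    have 1: "bracketed_product R 1 a" "bracketed_product R 1 c"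
      using abc by (auto simp: bracketed_product_1)
    have 2: "bracketed_product R 2 (a \<otimes>\<^bsub>R\<^esub> b)" "bracketed_product R 2 (b \<otimes>\<^bsub>R\<^esub> c)"
      using abc by (auto simp: bracketed_product_2)
    have "bracketed_product R 3 ((a \<otimes>\<^bsub>R\<^esub> b) \<otimes>\<^bsub>R\<^esub> c)"
      using bracketed_product.mult[OF 2(1) 1(2)] by simp
    moreover have "bracketed_product R 3 (a \<otimes>\<^bsub>R\<^esub> (b \<otimes>\<^bsub>R\<^esub> c))"
      using bracketed_product.mult[OF 1(1) 2(2)] by (simp add: eval_nat_numeral)
    ultimately show "(a \<otimes>\<^bsub>R\<^esub> b) \<otimes>\<^bsub>R\<^esub> c = \<zero>\<^bsub>R\<^esub> \<and> a \<otimes>\<^bsub>R\<^esub> (b \<otimes>\<^bsub>R\<^esub> c) = \<zero>\<^bsub>R\<^esub>"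
      using nil unfolding ring_nilpotent_class_le_def by blast
  qed
next
  assume rhs: ?rhs
  show "ring_nilpotent_class_le 3 R"
    unfolding ring_nilpotent_class_le_def
  proof (intro allI impI)
    fix x assume "bracketed_product R 3 x"
    then show "x = \<zero>\<^bsub>R\<^esub>"
    proof cases
      case (mult m y n z)
      then have "m = Suc 0 \<and> n = 2 \<or> m = 2 \<and> n = Suc 0"
        using bracketed_product_pos[OF mult(3)] bracketed_product_pos[OF mult(4)] by auto
      with mult rhs show ?thesis by (auto simp: bracketed_product_1 bracketed_product_2)
    qed simp
  qed
qed


section \<open>Groups of nilpotency class at most two\<close>

text \<open>\<open>derived_set G (carrier G)\<close> is the set of all commutators of \<open>G\<close>.\<close>

definition group_nilpotent_class_le_2 :: "('a, 'm) monoid_scheme \<Rightarrow> bool" where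
  "group_nilpotent_class_le_2 G \<longleftrightarrow>
     (\<forall>c\<in>derived_set G (carrier G). \<forall>g\<in>carrier G. c \<otimes>\<^bsub>G\<^esub> g = g \<otimes>\<^bsub>G\<^esub> c)"


section \<open>Commuting and annihilating probabilities\<close>

definition Pr_c_group :: "('a, 'm) monoid_scheme \<Rightarrow> rat" where
  "Pr_c_group G =
     of_nat (card {(a, b) \<in> carrier G \<times> carrier G. a \<otimes>\<^bsub>G\<^esub> b = b \<otimes>\<^bsub>G\<^esub> a}) /
     of_nat (card (carrier G)) ^ 2"

definition Pr_c_ring :: "('a, 'm) ring_scheme \<Rightarrow> rat" where
  "Pr_c_ring R =
     of_nat (card {(x, y) \<in> carrier R \<times> carrier R. x \<otimes>\<^bsub>R\<^esub> y \<ominus>\<^bsub>R\<^esub> y \<otimes>\<^bsub>R\<^esub> x = \<zero>\<^bsub>R\<^esub>}) /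
     of_nat (card (carrier R)) ^ 2"

definition Pr_ann :: "('a, 'm) ring_scheme \<Rightarrow> rat" where
  "Pr_ann R =
     of_nat (card {(x, y) \<in> carrier R \<times> carrier R. x \<otimes>\<^bsub>R\<^esub> y = \<zero>\<^bsub>R\<^esub>}) /
     of_nat (card (carrier R)) ^ 2"

definition S_c_groups :: "'a monoid set \<Rightarrow> rat set" where
  "S_c_groups \<C> = {Pr_c_group G | G. G \<in> \<C>}"

definition S_c_rings :: "'a ring set \<Rightarrow> rat set" where
  "S_c_rings \<C> = {Pr_c_ring R | R. R \<in> \<C>}"

definition S_ann :: "'a ring set \<Rightarrow> rat set" where
  "S_ann \<C> = {Pr_ann R | R. R \<in> \<C>}"


section \<open>Classes of finite groups and rings\<close>

text \<open>
  A class consists of the structures whose carrier is a set of elements of a given type \<open>'a\<close>. Over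
  \<open>'a = nat\<close> every finite group and every finite ring occurs up to isomorphism.
\<close>

definition finite_rings :: "'a ring set" where
  "finite_rings = {R. nonassoc_ring R \<and> finite (carrier R)}"

definition finite_nil2_groups :: "'a monoid set" where
  "finite_nil2_groups = {G. group G \<and> finite (carrier G) \<and> group_nilpotent_class_le_2 G}"

definition finite_nil3_rings :: "'a ring set" where
  "finite_nil3_rings = {R \<in> finite_rings. ring_nilpotent_class_le 3 R}"

definition finite_sa_rings :: "'a ring set" where
  "finite_sa_rings = {R \<in> finite_rings. strongly_antisymmetric R}"

end

theory Submission
  imports Defs
begin

(* A finite ring R gives the group R x R with (a, b)(c, d) = (a + c, b + d + ac): it is associative
   because the product of R is biadditive, and (a, b), (c, d) commute iff ac = ca. Conversely, in a
   group G of class at most two the commutator is a bimultiplicative pairing of the abelian group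
   G/Z(G) with values in Z(G), so (x, a)(y, b) = (0, [x, y]) is a ring product on G/Z(G) x Z(G), and
   it vanishes iff x and y commute. The probabilities agree because all maps involved have fibres
   of constant size. *)

section \<open>Densities of binary relations\<close>

text \<open>All probabilities in question take this form, so comparing two of them means relating
  two binary predicates along a map.\<close>

definition pair_density :: "'a set \<Rightarrow> ('a \<Rightarrow> 'a \<Rightarrow> bool) \<Rightarrow> rat" where
  "pair_density A P = of_nat (card {(a, b) \<in> A \<times> A. P a b}) / of_nat (card A) ^ 2"

lemma card_constant_fibres:
  assumes "finite A" and "finite B" and "f \<in> A \<rightarrow> B"
    and "\<And>y. y \<in> B \<Longrightarrow> card {x \<in> A. f x = y} = k"
  shows "card A = k * card B"
proof -
  have "card A = (\<Sum>x\<in>A. 1)"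
    by simp
  also have "\<dots> = (\<Sum>y\<in>B. \<Sum>x\<in>{x \<in> A. f x = y}. 1)"
    using assms(1-3) by (intro sum.group[symmetric]) auto
  also have "\<dots> = k * card B"
    using assms(4) by simp
  finally show ?thesis .
qed

text \<open>Passing from \<open>B\<close> to \<open>A\<close> multiplies the number of related pairs
  by \<open>k * k\<close> and the size of the set by \<open>k\<close>, so the factor cancels in the
  quotient.\<close>

lemma pair_density_fibres:
  assumes A: "finite A" and B: "finite B" and f: "f \<in> A \<rightarrow> B"
    and fib: "\<And>y. y \<in> B \<Longrightarrow> card {x \<in> A. f x = y} = k" and "k \<noteq> 0"
    and PQ: "\<And>a b. a \<in> A \<Longrightarrow> b \<in> A \<Longrightarrow> P a b \<longleftrightarrow> Q (f a) (f b)"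
  shows "pair_density A P = pair_density B Q"
proof -
  have "card {p \<in> {(a, b) \<in> A \<times> A. P a b}. map_prod f f p = q} = k * k"
    if q: "q \<in> {(a, b) \<in> B \<times> B. Q a b}" for q
  proof -
    \<comment> \<open>The condition \<open>P\<close> disappears on the right: over a pair
      \<open>q\<close> that satisfies \<open>Q\<close> it holds automatically by
      \<open>PQ\<close>.\<close>
    have "{p \<in> {(a, b) \<in> A \<times> A. P a b}. map_prod f f p = q} =
        {x \<in> A. f x = fst q} \<times> {x \<in> A. f x = snd q}"
      using q PQ by (auto simp: map_prod_def)
    then show ?thesis
      using q fib by (auto simp: card_cartesian_product)
  qed
  moreover have "finite {(a, b) \<in> A \<times> A. P a b}" "finite {(a, b) \<in> B \<times> B. Q a b}"
    using A B by (auto intro: finite_subset[of _ "A \<times> A"] finite_subset[of _ "B \<times> B"])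
  moreover have "map_prod f f \<in> {(a, b) \<in> A \<times> A. P a b} \<rightarrow> {(a, b) \<in> B \<times> B. Q a b}"
    using f PQ by auto
  ultimately have "card {(a, b) \<in> A \<times> A. P a b} = k * k * card {(a, b) \<in> B \<times> B. Q a b}"
    by (intro card_constant_fibres[where f = "map_prod f f"]) auto
  moreover have "card A = k * card B"
    using A B f fib by (rule card_constant_fibres)
  ultimately show ?thesis
    using \<open>k \<noteq> 0\<close> by (simp add: pair_density_def power2_eq_square)
qed

text \<open>Both constructions live on a product whose second factor does not influence the
  relation. This lemma discards that factor, as each fibre of \<open>fst\<close> is a copy of
  \<open>B\<close>.\<close>

lemma pair_density_fst:
  assumes "finite A" and "finite B" and "B \<noteq> {}"
    and "\<And>a b. a \<in> A \<times> B \<Longrightarrow> b \<in> A \<times> B \<Longrightarrow> P a b \<longleftrightarrow> Q (fst a) (fst b)"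
  shows "pair_density (A \<times> B) P = pair_density A Q"
proof (rule pair_density_fibres[where f = fst and k = "card B"])
  show "card {x \<in> A \<times> B. fst x = y} = card B" if "y \<in> A" for y
  proof -
    have "{x \<in> A \<times> B. fst x = y} = {y} \<times> B"
      using that by auto
    then show ?thesis
      by (simp add: card_cartesian_product)
  qed
qed (use assms in auto)

text \<open>Fibres of an injection onto its image are singletons, so renaming elements preserves a
  density. This serves to move structures to the natural numbers.\<close>

lemma pair_density_image:
  assumes "finite A" and f: "inj_on f A"
    and "\<And>a b. a \<in> A \<Longrightarrow> b \<in> A \<Longrightarrow> P a b \<longleftrightarrow> Q (f a) (f b)"
  shows "pair_density A P = pair_density (f ` A) Q"
proof (rule pair_density_fibres[where f = f and k = 1])
  show "card {x \<in> A. f x = y} = 1" if "y \<in> f ` A" for y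
  proof -
    from that obtain a where "a \<in> A" "y = f a"
      by blast
    then have "{x \<in> A. f x = y} = {a}"
      using f by (auto dest: inj_onD)
    then show ?thesis
      by simp
  qed
qed (use assms in auto)

lemma Pr_c_group_eq_pair_density:
  "Pr_c_group G = pair_density (carrier G) (\<lambda>a b. a \<otimes>\<^bsub>G\<^esub> b = b \<otimes>\<^bsub>G\<^esub> a)"
  by (simp add: Pr_c_group_def pair_density_def)

lemma Pr_ann_eq_pair_density:
  "Pr_ann R = pair_density (carrier R) (\<lambda>x y. x \<otimes>\<^bsub>R\<^esub> y = \<zero>\<^bsub>R\<^esub>)"
  by (simp add: Pr_ann_def pair_density_def)

section \<open>Transport of structure\<close>

lemma nil2_iff_commutators_central:
  "group_nilpotent_class_le_2 G \<longleftrightarrow>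
     (\<forall>x\<in>carrier G. \<forall>y\<in>carrier G. \<forall>g\<in>carrier G.
        (x \<otimes>\<^bsub>G\<^esub> y \<otimes>\<^bsub>G\<^esub> inv\<^bsub>G\<^esub> x \<otimes>\<^bsub>G\<^esub> inv\<^bsub>G\<^esub> y) \<otimes>\<^bsub>G\<^esub> g =
        g \<otimes>\<^bsub>G\<^esub> (x \<otimes>\<^bsub>G\<^esub> y \<otimes>\<^bsub>G\<^esub> inv\<^bsub>G\<^esub> x \<otimes>\<^bsub>G\<^esub> inv\<^bsub>G\<^esub> y))"
  by (auto simp: group_nilpotent_class_le_2_def)

text \<open>By surjectivity every commutator of \<open>H\<close> is the image of a commutator of
  \<open>G\<close>, and centrality is an equation that \<open>h\<close> preserves.\<close>

lemma (in group_hom) nil2_image: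
  assumes nil: "group_nilpotent_class_le_2 G" and surj: "h ` carrier G = carrier H"
  shows "group_nilpotent_class_le_2 H"
  unfolding nil2_iff_commutators_central surj[symmetric]
proof (clarify)
  fix x y g assume xyg: "x \<in> carrier G" "y \<in> carrier G" "g \<in> carrier G"
  then have "h ((x \<otimes> y \<otimes> inv x \<otimes> inv y) \<otimes> g) = h (g \<otimes> (x \<otimes> y \<otimes> inv x \<otimes> inv y))"
    using nil unfolding nil2_iff_commutators_central by metis
  with xyg show "(h x \<otimes>\<^bsub>H\<^esub> h y \<otimes>\<^bsub>H\<^esub> inv\<^bsub>H\<^esub> h x \<otimes>\<^bsub>H\<^esub> inv\<^bsub>H\<^esub> h y) \<otimes>\<^bsub>H\<^esub> h g =
      h g \<otimes>\<^bsub>H\<^esub> (h x \<otimes>\<^bsub>H\<^esub> h y \<otimes>\<^bsub>H\<^esub> inv\<^bsub>H\<^esub> h x \<otimes>\<^bsub>H\<^esub> inv\<^bsub>H\<^esub> h y)"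
    by simp
qed

text \<open>The group built from a ring consists of pairs, whereas the target class is over
  \<open>nat\<close>. An injection of the finite carrier into \<open>nat\<close> gives an isomorphic
  copy with the same probability.\<close>

lemma (in group) Pr_c_in_S_c_nil2_groups:
  assumes fin: "finite (carrier G)" and nil: "group_nilpotent_class_le_2 G"
  shows "Pr_c_group G \<in> S_c_groups (finite_nil2_groups :: nat monoid set)"
proof -
  obtain h :: "_ \<Rightarrow> nat" where h: "inj_on h (carrier G)"
    using fin finite_imp_inj_to_nat_seg by blast
  let ?k = "inv_into (carrier G) h"
  \<comment> \<open>The multiplication of \<open>G\<close> is conjugated by \<open>h\<close>, with
    \<open>?k\<close> as the inverse of \<open>h\<close> on its image, so that \<open>h\<close>
    becomes an isomorphism.\<close>
  define H :: "nat monoid" where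
    "H = \<lparr>carrier = h ` carrier G, mult = (\<lambda>x y. h (?k x \<otimes> ?k y)), one = h \<one>\<rparr>"
  have [simp]: "carrier H = h ` carrier G" "\<one>\<^bsub>H\<^esub> = h \<one>"
    by (auto simp: H_def)
  have [simp]: "h x \<otimes>\<^bsub>H\<^esub> h y = h (x \<otimes> y)" if "x \<in> carrier G" "y \<in> carrier G" for x y
    using that h by (simp add: H_def)
  have Pr: "Pr_c_group G = Pr_c_group H"
    unfolding Pr_c_group_eq_pair_density \<open>carrier H = h ` carrier G\<close>
    using fin h by (rule pair_density_image) (simp add: inj_on_eq_iff[OF h])
  have "group H"
  proof (rule groupI)
    fix x assume "x \<in> carrier H"
    then obtain a where "a \<in> carrier G" "x = h a"
      by auto
    then show "\<exists>y\<in>carrier H. y \<otimes>\<^bsub>H\<^esub> x = \<one>\<^bsub>H\<^esub>"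
      by (intro bexI[of _ "h (inv a)"]) auto
  qed (auto simp: m_assoc)
  then interpret H: group H .
  interpret group_hom G H h
    by unfold_locales (auto simp: hom_def)
  have "group_nilpotent_class_le_2 H"
    using nil by (rule nil2_image) simp
  then have "H \<in> finite_nil2_groups"
    using fin H.group_axioms by (simp add: finite_nil2_groups_def)
  with Pr show ?thesis
    by (auto simp: S_c_groups_def)
qed

lemma (in nonassoc_ring) zero_mult:
  assumes "x \<in> carrier R" shows "\<zero> \<otimes> x = \<zero>"
proof -
  have "\<zero> \<otimes> x \<oplus> \<zero> \<otimes> x = \<zero> \<otimes> x"
    using assms mult_add_left[of \<zero> \<zero> x] by (simp add: mult_closed)
  then show ?thesis
    using assms by (simp add: mult_closed)
qed

lemma (in nonassoc_ring) mult_zero: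
  assumes "x \<in> carrier R" shows "x \<otimes> \<zero> = \<zero>"
proof -
  have "x \<otimes> \<zero> \<oplus> x \<otimes> \<zero> = x \<otimes> \<zero>"
    using assms mult_add_right[of \<zero> \<zero> x] by (simp add: mult_closed)
  then show ?thesis
    using assms by (simp add: mult_closed)
qed

text \<open>The same transport for rings. All identities involved, including the vanishing of triple
  products, carry over along the injection \<open>h\<close>.\<close>

lemma (in nonassoc_ring) Pr_ann_in_S_ann_sa_nil3_rings:
  assumes fin: "finite (carrier R)"
    and sa: "strongly_antisymmetric R" and nil: "ring_nilpotent_class_le 3 R"
  shows "Pr_ann R \<in> S_ann (finite_sa_rings \<inter> finite_nil3_rings :: nat ring set)"
proof -
  note mult_closed [simp]
  obtain h :: "_ \<Rightarrow> nat" where h: "inj_on h (carrier R)"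
    using fin finite_imp_inj_to_nat_seg by blast
  let ?k = "inv_into (carrier R) h"
  define S :: "nat ring" where
    "S = \<lparr>carrier = h ` carrier R, mult = (\<lambda>x y. h (?k x \<otimes> ?k y)), one = 0,
          zero = h \<zero>, add = (\<lambda>x y. h (?k x \<oplus> ?k y))\<rparr>"
  have [simp]: "carrier S = h ` carrier R" "\<zero>\<^bsub>S\<^esub> = h \<zero>"
    by (auto simp: S_def)
  have [simp]: "h x \<otimes>\<^bsub>S\<^esub> h y = h (x \<otimes> y)" "h x \<oplus>\<^bsub>S\<^esub> h y = h (x \<oplus> y)"
    if "x \<in> carrier R" "y \<in> carrier R" for x y
    using that h by (simp_all add: S_def)
  have "abelian_group S"
  proof (rule abelian_groupI)
    fix x assume "x \<in> carrier S"
    then obtain a where "a \<in> carrier R" "x = h a"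
      by auto
    then show "\<exists>y\<in>carrier S. y \<oplus>\<^bsub>S\<^esub> x = \<zero>\<^bsub>S\<^esub>"
      by (intro bexI[of _ "h (\<ominus> a)"]) (auto simp: l_neg)
  qed (auto simp: a_ac)
  then have "nonassoc_ring S"
    by (rule nonassoc_ring.intro)
      (unfold_locales; auto simp: mult_add_left mult_add_right)
  moreover have "strongly_antisymmetric S"
    using sa by (auto simp: strongly_antisymmetric_def)
  moreover have "ring_nilpotent_class_le 3 S"
    using nil by (auto simp: ring_nilpotent_class_le_3_iff)
  ultimately have "S \<in> finite_sa_rings \<inter> finite_nil3_rings"
    using fin by (simp add: finite_sa_rings_def finite_nil3_rings_def finite_rings_def)
  moreover have "Pr_ann R = Pr_ann S"
    unfolding Pr_ann_eq_pair_density \<open>carrier S = h ` carrier R\<close>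
    using fin h by (intro pair_density_image) (auto simp: inj_on_eq_iff[OF h])
  ultimately show ?thesis
    by (auto simp: S_ann_def)
qed

section \<open>The group of a ring\<close>

text \<open>This is the central extension of the additive group of \<open>R\<close> by itself with
  the ring product as 2-cocycle.\<close>

definition ring_extension_group :: "('a, 'm) ring_scheme \<Rightarrow> ('a \<times> 'a) monoid" where
  "ring_extension_group R =
     \<lparr>carrier = carrier R \<times> carrier R,
      mult = (\<lambda>(a, b) (c, d). (a \<oplus>\<^bsub>R\<^esub> c, b \<oplus>\<^bsub>R\<^esub> d \<oplus>\<^bsub>R\<^esub> a \<otimes>\<^bsub>R\<^esub> c)),
      one = (\<zero>\<^bsub>R\<^esub>, \<zero>\<^bsub>R\<^esub>)\<rparr>"

context nonassoc_ring
begin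

text \<open>For associativity, both bracketings of \<open>(a, b)\<close>, \<open>(c, d)\<close>,
  \<open>(e, f)\<close> have second component \<open>b + d + f + ac + ae + ce\<close>, by the two
  distributive laws.\<close>

lemma group_ring_extension_group: "group (ring_extension_group R)"
proof (rule groupI)
  fix x assume "x \<in> carrier (ring_extension_group R)"
  then obtain a b where x: "x = (a, b)" "a \<in> carrier R" "b \<in> carrier R"
    by (auto simp: ring_extension_group_def)
  \<comment> \<open>The left inverse of \<open>(a, b)\<close> must have first component
    \<open>-a\<close>. The product then contributes the term \<open>(-a)a\<close>, so the second
    component has to cancel \<open>b + (-a)a\<close>.\<close>
  have "\<ominus> (b \<oplus> (\<ominus> a) \<otimes> a) \<oplus> b \<oplus> (\<ominus> a) \<otimes> a = \<ominus> (b \<oplus> (\<ominus> a) \<otimes> a) \<oplus> (b \<oplus> (\<ominus> a) \<otimes> a)"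
    using x by (simp add: a_assoc mult_closed)
  then show "\<exists>y\<in>carrier (ring_extension_group R).
      y \<otimes>\<^bsub>ring_extension_group R\<^esub> x = \<one>\<^bsub>ring_extension_group R\<^esub>"
    using x by (intro bexI[of _ "(\<ominus> a, \<ominus> (b \<oplus> (\<ominus> a) \<otimes> a))"])
      (auto simp: ring_extension_group_def l_neg mult_closed)
next
  fix x y z assume "x \<in> carrier (ring_extension_group R)" "y \<in> carrier (ring_extension_group R)"
    "z \<in> carrier (ring_extension_group R)"
  then show "x \<otimes>\<^bsub>ring_extension_group R\<^esub> y \<otimes>\<^bsub>ring_extension_group R\<^esub> z =
      x \<otimes>\<^bsub>ring_extension_group R\<^esub> (y \<otimes>\<^bsub>ring_extension_group R\<^esub> z)"
    by (auto simp: ring_extension_group_def mult_closed mult_add_left mult_add_right a_ac)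
qed (auto simp: ring_extension_group_def mult_closed zero_mult)

text \<open>Since addition is commutative, the two products can differ only in the ring products
  that enter the second component.\<close>

lemma ring_extension_group_commute_iff:
  assumes "x \<in> carrier R \<times> carrier R" and "y \<in> carrier R \<times> carrier R"
  shows "x \<otimes>\<^bsub>ring_extension_group R\<^esub> y = y \<otimes>\<^bsub>ring_extension_group R\<^esub> x \<longleftrightarrow>
    fst x \<otimes> fst y = fst y \<otimes> fst x"
proof -
  have "a \<oplus> b \<oplus> u = b \<oplus> a \<oplus> v \<longleftrightarrow> u = v"
    if "a \<in> carrier R" "b \<in> carrier R" "u \<in> carrier R" "v \<in> carrier R" for a b u v
    using that by (simp add: a_comm[of b a])
  then show ?thesis
    using assms by (auto simp: ring_extension_group_def mult_closed a_comm)
qed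

text \<open>The first projection is a homomorphism to an abelian group, so it sends commutators to
  zero. An element with first component zero is central, because zero annihilates \<open>R\<close>
  on both sides.\<close>

lemma nil2_ring_extension_group: "group_nilpotent_class_le_2 (ring_extension_group R)"
  unfolding nil2_iff_commutators_central
proof (intro ballI)
  let ?G = "ring_extension_group R"
  interpret G: group ?G by (rule group_ring_extension_group)
  have car: "carrier ?G = carrier R \<times> carrier R"
    and fst_mult: "fst (x \<otimes>\<^bsub>?G\<^esub> y) = fst x \<oplus> fst y" for x y
    by (auto simp: ring_extension_group_def split: prod.splits)
  fix x y g assume xyg: "x \<in> carrier ?G" "y \<in> carrier ?G" "g \<in> carrier ?G"
  define c where "c = x \<otimes>\<^bsub>?G\<^esub> y \<otimes>\<^bsub>?G\<^esub> inv\<^bsub>?G\<^esub> x \<otimes>\<^bsub>?G\<^esub> inv\<^bsub>?G\<^esub> y"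
  have c: "c \<in> carrier ?G"
    using xyg by (simp add: c_def)
  \<comment> \<open>Comparing first components in this equation yields \<open>fst c = 0\<close>
    without a formula for inverses in \<open>?G\<close>.\<close>
  have "c \<otimes>\<^bsub>?G\<^esub> (y \<otimes>\<^bsub>?G\<^esub> x) = x \<otimes>\<^bsub>?G\<^esub> y"
    using xyg by (simp add: c_def G.m_assoc G.inv_solve_left' flip: G.m_assoc)
      (simp add: G.m_assoc)
  from arg_cong[OF this, of fst] have "fst c \<oplus> (fst y \<oplus> fst x) = fst y \<oplus> fst x"
    using xyg by (auto simp: fst_mult car a_comm)
  then have "fst c = \<zero>"
    using xyg c by (auto simp: car)
  then have "c \<otimes>\<^bsub>?G\<^esub> g = g \<otimes>\<^bsub>?G\<^esub> c"
    using xyg c ring_extension_group_commute_iff[of c g]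
    by (auto simp: car zero_mult mult_zero)
  then show "x \<otimes>\<^bsub>?G\<^esub> y \<otimes>\<^bsub>?G\<^esub> inv\<^bsub>?G\<^esub> x \<otimes>\<^bsub>?G\<^esub> inv\<^bsub>?G\<^esub> y \<otimes>\<^bsub>?G\<^esub> g =
      g \<otimes>\<^bsub>?G\<^esub> (x \<otimes>\<^bsub>?G\<^esub> y \<otimes>\<^bsub>?G\<^esub> inv\<^bsub>?G\<^esub> x \<otimes>\<^bsub>?G\<^esub> inv\<^bsub>?G\<^esub> y)"
    by (simp add: c_def)
qed

text \<open>Commuting depends on first components only, so the second copy of \<open>R\<close> drops
  out of the density.\<close>

lemma Pr_c_ring_extension_group:
  assumes "finite (carrier R)"
  shows "Pr_c_group (ring_extension_group R) = Pr_c_ring R"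
proof -
  have "x \<ominus> y = \<zero> \<longleftrightarrow> x = y" if "x \<in> carrier R" "y \<in> carrier R" for x y
    using that by (metis add.inv_solve_right' l_zero minus_eq zero_closed)
  then have "{(x, y) \<in> carrier R \<times> carrier R. x \<otimes> y \<ominus> y \<otimes> x = \<zero>} =
      {(x, y) \<in> carrier R \<times> carrier R. x \<otimes> y = y \<otimes> x}"
    by (auto simp: mult_closed)
  then have "Pr_c_ring R = pair_density (carrier R) (\<lambda>x y. x \<otimes> y = y \<otimes> x)"
    by (simp add: Pr_c_ring_def pair_density_def)
  moreover have "carrier (ring_extension_group R) = carrier R \<times> carrier R"
    by (simp add: ring_extension_group_def)
  ultimately show ?thesis
    unfolding Pr_c_group_eq_pair_density
    using assms by (simp, intro pair_density_fst ring_extension_group_commute_iff) auto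
qed

end

section \<open>The ring of a group of class at most two\<close>

definition group_center :: "('a, 'm) monoid_scheme \<Rightarrow> 'a set" where
  "group_center G = {z \<in> carrier G. \<forall>g\<in>carrier G. z \<otimes>\<^bsub>G\<^esub> g = g \<otimes>\<^bsub>G\<^esub> z}"

definition commutator :: "('a, 'm) monoid_scheme \<Rightarrow> 'a \<Rightarrow> 'a \<Rightarrow> 'a" where
  "commutator G x y = x \<otimes>\<^bsub>G\<^esub> y \<otimes>\<^bsub>G\<^esub> inv\<^bsub>G\<^esub> x \<otimes>\<^bsub>G\<^esub> inv\<^bsub>G\<^esub> y"

text \<open>The additive structure is that of the direct product of \<open>G/Z(G)\<close> and
  \<open>Z(G)\<close>. The product is evaluated on chosen coset representatives;
  \<open>commutator_rep\<close> shows that in class at most two the choice is immaterial.\<close>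

definition commutator_ring :: "('a, 'm) monoid_scheme \<Rightarrow> ('a set \<times> 'a) ring" where
  "commutator_ring G =
     \<lparr>carrier = (rcosets\<^bsub>G\<^esub> group_center G) \<times> group_center G,
      mult = (\<lambda>(X, a) (Y, b). (group_center G, commutator G (SOME x. x \<in> X) (SOME y. y \<in> Y))),
      one = undefined,
      zero = (group_center G, \<one>\<^bsub>G\<^esub>),
      add = (\<lambda>(X, a) (Y, b). (X <#>\<^bsub>G\<^esub> Y, a \<otimes>\<^bsub>G\<^esub> b))\<rparr>"

section \<open>Commutators and the centre of an arbitrary group\<close>

context group
begin

lemma commutator_closed: "x \<in> carrier G \<Longrightarrow> y \<in> carrier G \<Longrightarrow> commutator G x y \<in> carrier G"
  by (simp add: commutator_def)

lemma commutator_swap: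
  assumes "x \<in> carrier G" and "y \<in> carrier G"
  shows "x \<otimes> y = commutator G x y \<otimes> (y \<otimes> x)"
  using assms by (simp add: commutator_def m_assoc[symmetric] inv_solve_right')
    (simp add: m_assoc)

text \<open>Cancelling \<open>y \<otimes> x\<close> on the right makes the commutator the unique
  solution of the equation in \<open>commutator_swap\<close>. Commutator identities can thus be
  proved by reordering products, without handling inverses.\<close>

lemma commutator_eqI:
  assumes "c \<in> carrier G" and "x \<in> carrier G" and "y \<in> carrier G" and "x \<otimes> y = c \<otimes> (y \<otimes> x)"
  shows "commutator G x y = c"
  using assms commutator_swap[of x y] by (simp add: commutator_closed)

lemma commutator_eq_one_iff:
  "x \<in> carrier G \<Longrightarrow> y \<in> carrier G \<Longrightarrow> commutator G x y = \<one> \<longleftrightarrow> x \<otimes> y = y \<otimes> x"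
  by (metis commutator_eqI commutator_swap l_one m_closed one_closed)

lemma subgroup_group_center: "subgroup (group_center G) G"
proof
  fix x assume x: "x \<in> group_center G"
  have "inv x \<otimes> g = g \<otimes> inv x" if g: "g \<in> carrier G" for g
  proof -
    have "x \<in> carrier G" "x \<otimes> g = g \<otimes> x"
      using x g by (auto simp: group_center_def)
    then show ?thesis
      using g by (metis inv_closed inv_solve_left inv_solve_right m_assoc m_closed)
  qed
  then show "inv x \<in> group_center G"
    using x by (auto simp: group_center_def)
next
  fix x y assume xy: "x \<in> group_center G" "y \<in> group_center G"
  have "x \<otimes> y \<otimes> g = g \<otimes> (x \<otimes> y)" if "g \<in> carrier G" for g
    using xy that unfolding group_center_def by (smt (verit) m_assoc mem_Collect_eq)
  moreover have "x \<in> carrier G" "y \<in> carrier G"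
    using xy by (simp_all add: group_center_def)
  ultimately show "x \<otimes> y \<in> group_center G"
    by (simp add: group_center_def)
qed (auto simp: group_center_def)

lemma normal_group_center: "group_center G \<lhd> G"
  unfolding normal_inv_iff
proof (intro conjI ballI subgroup_group_center)
  fix x h assume xh: "x \<in> carrier G" "h \<in> group_center G"
  then have "x \<otimes> h \<otimes> inv x = h"
    by (auto simp: group_center_def m_assoc) (metis inv_closed m_assoc r_inv r_one)
  with xh show "x \<otimes> h \<otimes> inv x \<in> group_center G"
    by simp
qed

lemma rcoset_group_center_eq_self_iff:
  assumes "x \<in> carrier G"
  shows "group_center G #> x = group_center G \<longleftrightarrow> x \<in> group_center G"
  using assms subgroup_group_center
  by (metis coset_join1 coset_join2 subgroup.subset)

end

section \<open>Class at most two: the commutator pairing and its ring\<close>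

locale nil2_group = group +
  assumes nil2: "group_nilpotent_class_le_2 G"
begin

lemma commutator_in_center:
  "x \<in> carrier G \<Longrightarrow> y \<in> carrier G \<Longrightarrow> commutator G x y \<in> group_center G"
  using nil2 unfolding nil2_iff_commutators_central
  by (auto simp: group_center_def commutator_def)

lemma commutator_commute:
  "x \<in> carrier G \<Longrightarrow> y \<in> carrier G \<Longrightarrow> g \<in> carrier G \<Longrightarrow>
    g \<otimes> commutator G x y = commutator G x y \<otimes> g"
  using commutator_in_center[of x y] unfolding group_center_def by simp

text \<open>Moving \<open>z\<close> to the left past \<open>y\<close> and then past \<open>x\<close>
  produces one commutator at each step. Both are central and can be collected in front.\<close>

lemma commutator_mult_left:
  assumes "x \<in> carrier G" and "y \<in> carrier G" and "z \<in> carrier G"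
  shows "commutator G (x \<otimes> y) z = commutator G x z \<otimes> commutator G y z"
proof (rule commutator_eqI)
  note [simp] = commutator_closed assms
  have "x \<otimes> y \<otimes> z = x \<otimes> (commutator G y z \<otimes> (z \<otimes> y))"
    by (simp add: m_assoc flip: commutator_swap)
  also have "\<dots> = x \<otimes> commutator G y z \<otimes> (z \<otimes> y)"
    by (simp add: m_assoc)
  also have "\<dots> = commutator G y z \<otimes> (x \<otimes> z) \<otimes> y"
    by (simp add: commutator_commute[of y z x]) (simp add: m_assoc)
  also have "\<dots> = commutator G y z \<otimes> commutator G x z \<otimes> (z \<otimes> (x \<otimes> y))"
    by (subst commutator_swap[of x z]) (simp_all add: m_assoc)
  finally show "x \<otimes> y \<otimes> z = commutator G x z \<otimes> commutator G y z \<otimes> (z \<otimes> (x \<otimes> y))"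
    by (simp add: commutator_commute[of x z "commutator G y z"])
qed (simp_all add: assms commutator_closed)

text \<open>Here \<open>z\<close> moves to the right past \<open>x\<close> and then past
  \<open>y\<close>, and again the central commutators are collected in front.\<close>

lemma commutator_mult_right:
  assumes "x \<in> carrier G" and "y \<in> carrier G" and "z \<in> carrier G"
  shows "commutator G z (x \<otimes> y) = commutator G z x \<otimes> commutator G z y"
proof (rule commutator_eqI)
  note [simp] = commutator_closed assms
  have "z \<otimes> (x \<otimes> y) = commutator G z x \<otimes> (x \<otimes> z) \<otimes> y"
    by (subst commutator_swap[symmetric]) (simp_all add: m_assoc)
  also have "\<dots> = commutator G z x \<otimes> (x \<otimes> (z \<otimes> y))"
    by (simp add: m_assoc)
  also have "\<dots> = commutator G z x \<otimes> (x \<otimes> commutator G z y \<otimes> (y \<otimes> z))"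
    by (subst commutator_swap[of z y]) (simp_all add: m_assoc)
  finally show "z \<otimes> (x \<otimes> y) = commutator G z x \<otimes> commutator G z y \<otimes> (x \<otimes> y \<otimes> z)"
    by (simp add: commutator_commute[of z y x]) (simp add: m_assoc)
qed (simp_all add: assms commutator_closed)

text \<open>The chosen representatives differ from \<open>x\<close> and \<open>y\<close> by central
  factors. Bimultiplicativity splits these off, and a commutator with a central entry is
  trivial.\<close>

lemma commutator_rep:
  assumes "x \<in> carrier G" and "y \<in> carrier G"
  shows "commutator G (SOME u. u \<in> group_center G #> x) (SOME v. v \<in> group_center G #> y) =
    commutator G x y"
proof -
  have rep: "\<exists>z\<in>group_center G. (SOME u. u \<in> group_center G #> x) = z \<otimes> x"
    if "x \<in> carrier G" for x
    using someI[of "\<lambda>u. u \<in> group_center G #> x" x] rcos_self[OF that subgroup_group_center]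
    by (auto simp: r_coset_def)
  from rep[OF assms(1)] rep[OF assms(2)] obtain z w
    where zw: "z \<in> group_center G" "(SOME u. u \<in> group_center G #> x) = z \<otimes> x"
      "w \<in> group_center G" "(SOME v. v \<in> group_center G #> y) = w \<otimes> y"
    by auto
  then have car: "z \<in> carrier G" "w \<in> carrier G"
    using subgroup.subset[OF subgroup_group_center] by auto
  have "commutator G a u = \<one>" "commutator G u a = \<one>"
    if "a \<in> group_center G" "u \<in> carrier G" for a u
    using that by (simp_all add: group_center_def commutator_eq_one_iff)
  with zw car show ?thesis
    using assms by (simp add: commutator_mult_left commutator_mult_right commutator_closed)
qed

text \<open>The last rule lets products be computed with any representatives, so the ring axioms can
  be checked without reference to the choice operator.\<close>

lemma commutator_ring_simps:
  shows "carrier (commutator_ring G) = (rcosets group_center G) \<times> group_center G"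
    and "\<zero>\<^bsub>commutator_ring G\<^esub> = (group_center G, \<one>)"
    and "(X, a) \<oplus>\<^bsub>commutator_ring G\<^esub> (Y, b) = (X <#> Y, a \<otimes> b)"
    and "\<lbrakk>x \<in> carrier G; y \<in> carrier G\<rbrakk> \<Longrightarrow>
      (group_center G #> x, a) \<otimes>\<^bsub>commutator_ring G\<^esub> (group_center G #> y, b) =
      (group_center G, commutator G x y)"
  by (simp_all add: commutator_ring_def commutator_rep)

lemma commutator_ring_cases:
  assumes "p \<in> carrier (commutator_ring G)"
  obtains x a where "x \<in> carrier G" "a \<in> group_center G" "p = (group_center G #> x, a)"
  using assms by (auto simp: commutator_ring_simps RCOSETS_def)

text \<open>The elements \<open>x \<otimes> y\<close> and \<open>y \<otimes> x\<close> differ by a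
  commutator, which lies in the centre. Hence the quotient by the centre is abelian, as the addition
  of the ring requires.\<close>

lemma rcoset_mult_commute:
  assumes "x \<in> carrier G" and "y \<in> carrier G"
  shows "group_center G #> (x \<otimes> y) = group_center G #> (y \<otimes> x)"
proof -
  have "group_center G #> (x \<otimes> y) = (group_center G #> commutator G x y) #> (y \<otimes> x)"
    using assms subgroup.subset[OF subgroup_group_center]
    by (simp add: coset_mult_assoc commutator_closed flip: commutator_swap)
  moreover have "group_center G #> commutator G x y = group_center G"
    using assms by (simp add: rcoset_group_center_eq_self_iff commutator_closed commutator_in_center)
  ultimately show ?thesis
    by simp
qed

text \<open>The additive group is a direct product of two abelian groups, and the distributive laws
  are the bimultiplicativity of the commutator.\<close>

lemma nonassoc_ring_commutator_ring: "nonassoc_ring (commutator_ring G)"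
proof -
  let ?Z = "group_center G" and ?R = "commutator_ring G"
  interpret Z: normal ?Z G by (rule normal_group_center)
  have rc: "?Z #> x \<in> rcosets ?Z" if "x \<in> carrier G" for x
    using that Z.subset by (simp add: rcosetsI)
  have Z_rc: "?Z \<in> rcosets ?Z"
    using rc[OF one_closed] Z.subset by (simp add: coset_mult_one)
  have central: "a \<otimes> b = b \<otimes> a" if "a \<in> ?Z" "b \<in> ?Z" for a b
    using that unfolding group_center_def by blast
  have Z_mult: "?Z <#> (?Z #> x) = ?Z #> x" if "x \<in> carrier G" for x
    using that by (simp add: Z.rcosets_mult_eq rc)
  have inv_ex: "\<exists>q\<in>carrier ?R. q \<oplus>\<^bsub>?R\<^esub> p = \<zero>\<^bsub>?R\<^esub>" if p: "p \<in> carrier ?R" for p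
  proof -
    from p obtain x a where xa: "x \<in> carrier G" "a \<in> ?Z" "p = (?Z #> x, a)"
      by (rule commutator_ring_cases)
    then show ?thesis
      using Z.subset by (intro bexI[of _ "(?Z #> inv x, inv a)"])
        (auto simp: commutator_ring_simps rc Z.rcos_sum coset_mult_one)
  qed
  have "abelian_group ?R"
  proof (rule abelian_groupI)
    show "p \<oplus>\<^bsub>?R\<^esub> q \<in> carrier ?R" if "p \<in> carrier ?R" "q \<in> carrier ?R" for p q
      using that
      by (elim commutator_ring_cases) (simp add: commutator_ring_simps rc Z.rcos_sum)
    show "\<zero>\<^bsub>?R\<^esub> \<in> carrier ?R"
      by (simp add: commutator_ring_simps Z_rc)
    show "p \<oplus>\<^bsub>?R\<^esub> q \<oplus>\<^bsub>?R\<^esub> r = p \<oplus>\<^bsub>?R\<^esub> (q \<oplus>\<^bsub>?R\<^esub> r)"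
      if "p \<in> carrier ?R" "q \<in> carrier ?R" "r \<in> carrier ?R" for p q r
      using that
      by (elim commutator_ring_cases) (simp add: commutator_ring_simps Z.rcos_sum m_assoc)
    show "p \<oplus>\<^bsub>?R\<^esub> q = q \<oplus>\<^bsub>?R\<^esub> p" if "p \<in> carrier ?R" "q \<in> carrier ?R" for p q
      using that
      by (elim commutator_ring_cases)
        (simp add: commutator_ring_simps Z.rcos_sum central rcoset_mult_commute)
    show "\<zero>\<^bsub>?R\<^esub> \<oplus>\<^bsub>?R\<^esub> p = p" if "p \<in> carrier ?R" for p
      using that by (elim commutator_ring_cases) (simp add: commutator_ring_simps Z_mult)
  qed (rule inv_ex)
  moreover have "nonassoc_ring_axioms ?R"
  proof
    \<comment> \<open>Every product has the zero coset \<open>?Z\<close> as first component, so a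
      sum of two products has \<open>?Z <#> ?Z\<close> there.\<close>
    have Z_Z: "?Z <#> ?Z = ?Z"
      using Z_mult[OF one_closed] Z.subset by (simp add: coset_mult_one)
    fix p q assume pq: "p \<in> carrier ?R" "q \<in> carrier ?R"
    then show "p \<otimes>\<^bsub>?R\<^esub> q \<in> carrier ?R"
      by (elim commutator_ring_cases) (simp add: commutator_ring_simps Z_rc commutator_in_center)
    fix r assume "r \<in> carrier ?R"
    with pq show "(p \<oplus>\<^bsub>?R\<^esub> q) \<otimes>\<^bsub>?R\<^esub> r = p \<otimes>\<^bsub>?R\<^esub> r \<oplus>\<^bsub>?R\<^esub> q \<otimes>\<^bsub>?R\<^esub> r"
      and "r \<otimes>\<^bsub>?R\<^esub> (p \<oplus>\<^bsub>?R\<^esub> q) = r \<otimes>\<^bsub>?R\<^esub> p \<oplus>\<^bsub>?R\<^esub> r \<otimes>\<^bsub>?R\<^esub> q"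
      by (elim commutator_ring_cases,
          simp add: commutator_ring_simps Z.rcos_sum Z_Z commutator_mult_left commutator_mult_right)+
  qed
  ultimately show ?thesis
    by (rule nonassoc_ring.intro)
qed

lemma strongly_antisymmetric_commutator_ring: "strongly_antisymmetric (commutator_ring G)"
  unfolding strongly_antisymmetric_def
proof
  fix p assume "p \<in> carrier (commutator_ring G)"
  then show "p \<otimes>\<^bsub>commutator_ring G\<^esub> p = \<zero>\<^bsub>commutator_ring G\<^esub>"
    by (rule commutator_ring_cases) (simp add: commutator_ring_simps commutator_eq_one_iff)
qed

text \<open>Every product has the trivial coset as its first component. Multiplying it by a further
  element gives a commutator with entry \<open>\<one>\<close>, which is trivial.\<close>

lemma nil3_commutator_ring: "ring_nilpotent_class_le 3 (commutator_ring G)"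
proof -
  let ?R = "commutator_ring G"
  have "(group_center G, c) \<otimes>\<^bsub>?R\<^esub> p = \<zero>\<^bsub>?R\<^esub>" "p \<otimes>\<^bsub>?R\<^esub> (group_center G, c) = \<zero>\<^bsub>?R\<^esub>"
    if "p \<in> carrier ?R" for p c
  proof -
    \<comment> \<open>Writing the centre as the coset of \<open>\<one>\<close> makes the product
      rule for cosets applicable.\<close>
    have "group_center G #> \<one> = group_center G"
      using subgroup.subset[OF subgroup_group_center] by (rule coset_mult_one)
    with that show "(group_center G, c) \<otimes>\<^bsub>?R\<^esub> p = \<zero>\<^bsub>?R\<^esub>" "p \<otimes>\<^bsub>?R\<^esub> (group_center G, c) = \<zero>\<^bsub>?R\<^esub>"
      using commutator_ring_simps(4)[of \<one> _ c] commutator_ring_simps(4)[of _ \<one> _ c]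
      by (auto elim!: commutator_ring_cases simp: commutator_ring_simps(2) commutator_eq_one_iff)
  qed
  moreover have "\<exists>c. p \<otimes>\<^bsub>?R\<^esub> q = (group_center G, c)" for p q
    by (simp add: commutator_ring_def split_beta)
  ultimately show ?thesis
    unfolding ring_nilpotent_class_le_3_iff by metis
qed

text \<open>Both sides equal the density of \<open>?Q\<close> on the cosets of the centre: the
  quotient map of \<open>G\<close> and the projection of the ring to its first factor each have
  fibres of size \<open>card ?Z\<close>.\<close>

lemma Pr_ann_commutator_ring:
  assumes fin: "finite (carrier G)"
  shows "Pr_ann (commutator_ring G) = Pr_c_group G"
proof -
  let ?Z = "group_center G" and ?R = "commutator_ring G"
  let ?Q = "\<lambda>X Y. commutator G (SOME x. x \<in> X) (SOME y. y \<in> Y) = \<one>"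
  have Z: "?Z \<subseteq> carrier G" "?Z \<noteq> {}"
    using subgroup.subset[OF subgroup_group_center] subgroup.one_closed[OF subgroup_group_center]
    by auto
  then have finZ: "finite ?Z"
    using fin finite_subset by blast
  have finQ: "finite (rcosets ?Z)"
    using fin by (simp add: RCOSETS_def)
  have "Pr_c_group G = pair_density (rcosets ?Z) ?Q"
    unfolding Pr_c_group_eq_pair_density
  proof (rule pair_density_fibres[where f = "\<lambda>x. ?Z #> x" and k = "card ?Z"])
    \<comment> \<open>The fibre over a coset \<open>X\<close> is \<open>X\<close> itself, and all
      cosets of the centre have the same size.\<close>
    show "card {x \<in> carrier G. ?Z #> x = X} = card ?Z" if X: "X \<in> rcosets ?Z" for X
    proof -
      obtain g where g: "g \<in> carrier G" "X = ?Z #> g"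
        using X by (auto simp: RCOSETS_def)
      have "X \<subseteq> carrier G"
        using g Z(1) r_coset_subset_G by simp
      moreover have "?Z #> x = X" if "x \<in> X" for x
        using that g repr_independence subgroup_group_center by metis
      moreover have "x \<in> X" if "x \<in> carrier G" "?Z #> x = X" for x
        using that rcos_self subgroup_group_center by metis
      ultimately have "{x \<in> carrier G. ?Z #> x = X} = X"
        by blast
      then show ?thesis
        using card_rcosets_equal[OF X Z(1)] by simp
    qed
  qed (use fin finQ finZ Z in \<open>auto simp: rcosetsI commutator_rep commutator_eq_one_iff\<close>)
  moreover have "Pr_ann ?R = pair_density (rcosets ?Z) ?Q"
    unfolding Pr_ann_eq_pair_density commutator_ring_simps
    using finQ finZ Z(2)
    by (intro pair_density_fst) (auto simp: commutator_ring_def)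
  ultimately show ?thesis
    by simp
qed

end

theorem theorem2p1:
  shows "S_c_rings (finite_rings :: 'a ring set) \<subseteq> S_c_groups (finite_nil2_groups :: nat monoid set)
    \<and> S_c_groups (finite_nil2_groups :: 'b monoid set)
        \<subseteq> S_ann (finite_sa_rings \<inter> finite_nil3_rings :: nat ring set)"
proof (intro conjI subsetI)
  fix p assume "p \<in> S_c_rings (finite_rings :: 'a ring set)"
  then obtain R :: "'a ring" where "nonassoc_ring R" and fin: "finite (carrier R)"
    and p: "p = Pr_c_ring R"
    by (auto simp: S_c_rings_def finite_rings_def)
  interpret nonassoc_ring R by fact
  have "finite (carrier (ring_extension_group R))"
    using fin by (simp add: ring_extension_group_def)
  then show "p \<in> S_c_groups (finite_nil2_groups :: nat monoid set)"
    using group.Pr_c_in_S_c_nil2_groups[OF group_ring_extension_group]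
      nil2_ring_extension_group Pr_c_ring_extension_group[OF fin] p by metis
next
  fix p assume "p \<in> S_c_groups (finite_nil2_groups :: 'b monoid set)"
  then obtain G :: "'b monoid" where G: "group G" "group_nilpotent_class_le_2 G"
    and fin: "finite (carrier G)" and p: "p = Pr_c_group G"
    by (auto simp: S_c_groups_def finite_nil2_groups_def)
  interpret nil2_group G
    using G by (intro nil2_group.intro nil2_group_axioms.intro)
  have "finite (carrier (commutator_ring G))"
    using fin by (auto simp: commutator_ring_simps RCOSETS_def group_center_def)
  then show "p \<in> S_ann (finite_sa_rings \<inter> finite_nil3_rings :: nat ring set)"
    using nonassoc_ring.Pr_ann_in_S_ann_sa_nil3_rings[OF nonassoc_ring_commutator_ring]
      strongly_antisymmetric_commutator_ring nil3_commutator_ring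
      Pr_ann_commutator_ring[OF fin] p by metis
qed

end
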